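(* Let $\mathcal{T}$ be a countable a.d.f.s. family, $\lambda$ a cardinal, $p\in\mathbb{S}^\lambda$ and $\dot f$ an $\mathbb{S}^\lambda$-name for a real (an element of $\omega^\omega$) such that for all $T\in\mathcal{T}$ we have $p\Vdash\dot f\notin[T]$. Then there are a finitely splitting tree $S$ and $q\le p$ such that $\mathcal{T}\cup\{S\}$ is an a.d.f.s. family and $q\Vdash\dot f\in[S]$.
   Context: A tree is a nonempty $T\subseteq\omega^{<\omega}$ closed under initial segments; it is finitely splitting if every $s\in T$ has at least one and only finitely many immediate successors in $T$. $[T]=\{f\in\omega^\omega\mid\forall n\ f\restriction n\in T\}$ (evaluated in the relevant model). An a.d.f.s. family is a set $\mathcal{T}$ of finitely splitting trees such that $S\cap T$ is finite for all distinct $S,T\in\mathcal{T}$. $\mathbb{S}^\lambda$ is the countable support product of $\lambda$ many copies of Sacks forcing $\mathbb{S}$, where $\mathbb{S}$ is the set of perfect trees $T\subseteq2^{<\omega}$ (every node of $T$ has an extension $t\in T$ with $t^\frown 0,t^\frown1\in T$), ordered by inclusion. *)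

theory Defs
  imports Main "HOL-Library.Sublist" "HOL-Library.Countable_Set" "HOL-Library.FuncSet"
begin

section \<open>Trees\<close>

text \<open>The sets \<open>\<omega>\<^sup><\<^sup>\<omega>\<close> and \<open>2\<^sup><\<^sup>\<omega>\<close> are the types \<open>nat list\<close> and \<open>bool list\<close>.\<close>

definition tree :: "'a list set \<Rightarrow> bool" where
  "tree T \<longleftrightarrow> T \<noteq> {} \<and> (\<forall>t\<in>T. \<forall>s. prefix s t \<longrightarrow> s \<in> T)"

definition fin_splitting_tree :: "nat list set \<Rightarrow> bool" where
  "fin_splitting_tree T \<longleftrightarrow>
     tree T \<and> (\<forall>s\<in>T. {n. s @ [n] \<in> T} \<noteq> {} \<and> finite {n. s @ [n] \<in> T})"

definition adfs_family :: "nat list set set \<Rightarrow> bool" where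
  "adfs_family \<T> \<longleftrightarrow>
     (\<forall>T\<in>\<T>. fin_splitting_tree T) \<and> (\<forall>S\<in>\<T>. \<forall>T\<in>\<T>. S \<noteq> T \<longrightarrow> finite (S \<inter> T))"

definition perfect_tree :: "bool list set \<Rightarrow> bool" where
  "perfect_tree T \<longleftrightarrow>
     tree T \<and> (\<forall>s\<in>T. \<exists>t\<in>T. prefix s t \<and> t @ [False] \<in> T \<and> t @ [True] \<in> T)"


section \<open>Forcing notions, names and the forcing relation\<close>

record 'p forcing =
  conds :: "'p set"
  leq :: "'p \<Rightarrow> 'p \<Rightarrow> bool"
  top_cond :: 'p

definition below :: "'p forcing \<Rightarrow> 'p \<Rightarrow> 'p set" where
  "below P p = {r \<in> conds P. leq P r p}"

definition dense_below :: "'p forcing \<Rightarrow> 'p \<Rightarrow> 'p set \<Rightarrow> bool" where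
  "dense_below P p D \<longleftrightarrow> (\<forall>r\<in>below P p. \<exists>r'\<in>below P r. r' \<in> D)"

text \<open>
  \<open>Name F\<close> is the name whose members are the pairs in the range of the partial function \<open>F\<close>. A
  recursive datatype cannot contain an unrestricted set of pairs of a name and a condition, so
  the members are indexed by a type. As the type variable \<open>'i\<close> is arbitrary, there is no bound
  on the size of names; the summand \<open>nat\<close> only guarantees that every finite set has a name.
\<close>
datatype ('i, 'p) name = Name "'i + nat \<rightharpoonup> ('i, 'p) name \<times> 'p"

primrec members :: "('i, 'p) name \<Rightarrow> (('i, 'p) name \<times> 'p) set" where
  "members (Name F) = ran F"

inductive is_name :: "'p forcing \<Rightarrow> ('i, 'p) name \<Rightarrow> bool" for P where
  "(\<And>c s. (c, s) \<in> members a \<Longrightarrow> s \<in> conds P \<and> is_name P c) \<Longrightarrow> is_name P a"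

lemma name_induct_members:
  assumes "\<And>a. (\<And>c s. (c, s) \<in> members a \<Longrightarrow> Q c) \<Longrightarrow> Q a"
  shows "Q a"
proof (induction a)
  case (Name F)
  show ?case
  proof (rule assms)
    fix c s assume "(c, s) \<in> members (Name F)"
    then obtain i where "F i = Some (c, s)" by (auto simp: ran_def)
    then show "Q c"
      by (intro Name.IH[of "Some (c, s)" "(c, s)" c]) (simp_all add: range_eqI[of _ F i])
  qed
qed

lemma wf_name: "wf {(c, a :: ('i, 'p) name). \<exists>s. (c, s) \<in> members a}"
proof (rule wfUNIVI)
  fix Q :: "('i, 'p) name \<Rightarrow> bool" and a
  assume *: "\<forall>a. (\<forall>c. (c, a) \<in> {(c, a). \<exists>s. (c, s) \<in> members a} \<longrightarrow> Q c) \<longrightarrow> Q a"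
  show "Q a"
    by (rule name_induct_members) (use * in blast)
qed

text \<open>
  \<open>forces_eq P a b p\<close> and \<open>forces_mem P a b p\<close> mean that \<open>p\<close> forces \<open>a = b\<close> and \<open>a \<in> b\<close>,
  respectively. The usual simultaneous recursion is turned into a recursion on the first
  argument of \<open>forces_eq\<close>; \<open>forces_eq_iff\<close> below is its familiar form.
\<close>
function forces_eq :: "'p forcing \<Rightarrow> ('i, 'p) name \<Rightarrow> ('i, 'p) name \<Rightarrow> 'p \<Rightarrow> bool" where
  "forces_eq P a b p \<longleftrightarrow>
     (\<forall>(c, s)\<in>members a. \<forall>r\<in>below P p. leq P r s \<longrightarrow>
        dense_below P r {r'. \<exists>(d, t)\<in>members b. leq P r' t \<and> forces_eq P c d r'}) \<and>
     (\<forall>(d, t)\<in>members b. \<forall>r\<in>below P p. leq P r t \<longrightarrow>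
        dense_below P r {r'. \<exists>(c, s)\<in>members a. leq P r' s \<and> forces_eq P c d r'})"
  by pat_completeness auto
termination
  by (relation "inv_image {(c, a). \<exists>s. (c, s) \<in> members a} (\<lambda>(P, a, b, p). a)")
    (rule wf_inv_image[OF wf_name], auto)

declare forces_eq.simps [simp del]

definition forces_mem :: "'p forcing \<Rightarrow> ('i, 'p) name \<Rightarrow> ('i, 'p) name \<Rightarrow> 'p \<Rightarrow> bool" where
  "forces_mem P a b p \<longleftrightarrow>
     dense_below P p {r. \<exists>(d, t)\<in>members b. leq P r t \<and> forces_eq P a d r}"

lemma forces_eq_sym: "forces_eq P a b p \<longleftrightarrow> forces_eq P b a p"
proof (induction a arbitrary: b p rule: name_induct_members)
  case (1 a)
  have eq: "forces_eq P c = (\<lambda>d. forces_eq P d c)" if "(c, s) \<in> members a" for c s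
    using 1[OF that] by (intro ext)
  have *: "(\<forall>(c, s)\<in>members a. \<forall>r\<in>below P p. leq P r s \<longrightarrow>
             dense_below P r {r'. \<exists>(d, t)\<in>members b. leq P r' t \<and> forces_eq P c d r'}) \<longleftrightarrow>
           (\<forall>(c, s)\<in>members a. \<forall>r\<in>below P p. leq P r s \<longrightarrow>
             dense_below P r {r'. \<exists>(d, t)\<in>members b. leq P r' t \<and> forces_eq P d c r'})"
  proof (intro ball_cong[OF refl])
    fix x assume "x \<in> members a"
    then obtain c s where x: "x = (c, s)" and c: "(c, s) \<in> members a" by (cases x) auto
    show "(case x of (c, s) \<Rightarrow> \<forall>r\<in>below P p. leq P r s \<longrightarrow>
             dense_below P r {r'. \<exists>(d, t)\<in>members b. leq P r' t \<and> forces_eq P c d r'}) =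
          (case x of (c, s) \<Rightarrow> \<forall>r\<in>below P p. leq P r s \<longrightarrow>
             dense_below P r {r'. \<exists>(d, t)\<in>members b. leq P r' t \<and> forces_eq P d c r'})"
      unfolding x prod.case eq[OF c] by (rule refl)
  qed
  have **: "(\<exists>(c, s)\<in>members a. leq P r s \<and> forces_eq P c d r) \<longleftrightarrow>
            (\<exists>(c, s)\<in>members a. leq P r s \<and> forces_eq P d c r)" for d r
    using 1 by blast
  show ?case
    unfolding forces_eq.simps[of P a b] forces_eq.simps[of P b a] * ** by (rule conj_commute)
qed

lemma forces_eq_iff:
  "forces_eq P a b p \<longleftrightarrow>
     (\<forall>(c, s)\<in>members a. \<forall>r\<in>below P p. leq P r s \<longrightarrow> forces_mem P c b r) \<and>
     (\<forall>(d, t)\<in>members b. \<forall>r\<in>below P p. leq P r t \<longrightarrow> forces_mem P d a r)"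
proof -
  have "forces_mem P d a r \<longleftrightarrow>
      dense_below P r {r'. \<exists>(c, s)\<in>members a. leq P r' s \<and> forces_eq P c d r'}" for d r
    unfolding forces_mem_def using forces_eq_sym[of P d] by presburger
  then show ?thesis
    unfolding forces_eq.simps[of P a b] by (simp only: forces_mem_def)
qed

text \<open>
  Compound statements of the forcing language are represented by the predicate of being
  forced. \<open>f_all\<close> and \<open>f_ex\<close> quantify over the elements of a ground model set (so they are
  the quantifiers bounded by its check name), \<open>f_all_in\<close> over the elements of the set named by \<open>a\<close>.
\<close>

definition f_not :: "'p forcing \<Rightarrow> ('p \<Rightarrow> bool) \<Rightarrow> 'p \<Rightarrow> bool" where
  "f_not P \<phi> p \<longleftrightarrow> (\<forall>r\<in>below P p. \<not> \<phi> r)"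

definition f_and :: "('p \<Rightarrow> bool) \<Rightarrow> ('p \<Rightarrow> bool) \<Rightarrow> 'p \<Rightarrow> bool" where
  "f_and \<phi> \<psi> p \<longleftrightarrow> \<phi> p \<and> \<psi> p"

definition f_all :: "'x set \<Rightarrow> ('x \<Rightarrow> 'p \<Rightarrow> bool) \<Rightarrow> 'p \<Rightarrow> bool" where
  "f_all X \<phi> p \<longleftrightarrow> (\<forall>x\<in>X. \<phi> x p)"

definition f_ex :: "'p forcing \<Rightarrow> 'x set \<Rightarrow> ('x \<Rightarrow> 'p \<Rightarrow> bool) \<Rightarrow> 'p \<Rightarrow> bool" where
  "f_ex P X \<phi> p \<longleftrightarrow> dense_below P p {r. \<exists>x\<in>X. \<phi> x r}"

definition f_all_in ::
  "'p forcing \<Rightarrow> ('i, 'p) name \<Rightarrow> (('i, 'p) name \<Rightarrow> 'p \<Rightarrow> bool) \<Rightarrow> 'p \<Rightarrow> bool" where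
  "f_all_in P a \<phi> p \<longleftrightarrow>
     (\<forall>(c, s)\<in>members a. \<forall>r\<in>below P p. leq P r s \<longrightarrow> \<phi> c r)"


section \<open>Names for reals\<close>

text \<open>\<open>fin_set_name P [a\<^sub>1, \<dots>, a\<^sub>n]\<close> is the name \<open>{(a\<^sub>1, 1), \<dots>, (a\<^sub>n, 1)}\<close> of the set with these elements.\<close>

definition fin_set_name :: "'p forcing \<Rightarrow> ('i, 'p) name list \<Rightarrow> ('i, 'p) name" where
  "fin_set_name P as = Name (case_sum (\<lambda>_. None)
     (\<lambda>k. if k < length as then Some (as ! k, top_cond P) else None))"

text \<open>Check names of the von Neumann numerals \<open>n = {0, \<dots>, n - 1}\<close> and of the Kuratowski pairs
  \<open>(m, n) = {{m}, {m, n}}\<close>.\<close>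

primrec nat_checks :: "'p forcing \<Rightarrow> nat \<Rightarrow> ('i, 'p) name list" where
  "nat_checks P 0 = []"
| "nat_checks P (Suc n) = nat_checks P n @ [fin_set_name P (nat_checks P n)]"

definition nat_check :: "'p forcing \<Rightarrow> nat \<Rightarrow> ('i, 'p) name" where
  "nat_check P n = fin_set_name P (nat_checks P n)"

definition pair_check :: "'p forcing \<Rightarrow> nat \<Rightarrow> nat \<Rightarrow> ('i, 'p) name" where
  "pair_check P m n =
     fin_set_name P [fin_set_name P [nat_check P m], fin_set_name P [nat_check P m, nat_check P n]]"

text \<open>The statement \<open>f(n) = m\<close>, i.e. \<open>(n, m) \<in> f\<close>.\<close>

definition f_value :: "'p forcing \<Rightarrow> ('i, 'p) name \<Rightarrow> nat \<Rightarrow> nat \<Rightarrow> 'p \<Rightarrow> bool" where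
  "f_value P f n m = forces_mem P (pair_check P n m) f"

text \<open>The statement \<open>f \<in> \<omega>\<^sup>\<omega>\<close>: \<open>f \<subseteq> \<omega> \<times> \<omega>\<close>, and for each \<open>n\<close> there is exactly one \<open>m\<close> with \<open>(n, m) \<in> f\<close>.\<close>

definition f_real :: "'p forcing \<Rightarrow> ('i, 'p) name \<Rightarrow> 'p \<Rightarrow> bool" where
  "f_real P f = f_and
     (f_all_in P f (\<lambda>x. f_ex P UNIV (\<lambda>(n, m). forces_eq P x (pair_check P n m))))
     (f_all UNIV (\<lambda>n. f_ex P UNIV (\<lambda>m. f_and
        (f_value P f n m)
        (f_all {m'. m' \<noteq> m} (\<lambda>m'. f_not P (f_value P f n m'))))))"

definition name_for_real :: "'p forcing \<Rightarrow> ('i, 'p) name \<Rightarrow> bool" where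
  "name_for_real P f \<longleftrightarrow> is_name P f \<and> f_real P f (top_cond P)"

text \<open>The statement \<open>f \<in> [T]\<close> for a real \<open>f\<close>: for all \<open>n\<close> there is \<open>t \<in> T\<close> with \<open>f \<restriction> n = t\<close>.\<close>

definition f_branch :: "'p forcing \<Rightarrow> ('i, 'p) name \<Rightarrow> nat list set \<Rightarrow> 'p \<Rightarrow> bool" where
  "f_branch P f T =
     f_all UNIV (\<lambda>n. f_ex P {t \<in> T. length t = n} (\<lambda>t. f_all {..<n} (\<lambda>k. f_value P f k (t ! k))))"


section \<open>Countable support products of Sacks forcing\<close>

text \<open>The index set \<open>L\<close> plays the role of the cardinal \<open>\<lambda>\<close>. Conditions are functions with domain
  \<open>L\<close>, hence \<open>PiE\<close>; the largest element of Sacks forcing is the full tree \<open>UNIV\<close>.\<close>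

definition sacks_product :: "'l set \<Rightarrow> ('l \<Rightarrow> bool list set) forcing" where
  "sacks_product L =
     \<lparr>conds = {p \<in> L \<rightarrow>\<^sub>E {T. perfect_tree T}. countable {i \<in> L. p i \<noteq> UNIV}},
      leq = (\<lambda>q p. \<forall>i\<in>L. q i \<subseteq> p i),
      top_cond = (\<lambda>i\<in>L. UNIV)\<rparr>"

end

theory Submission
  imports Defs
begin

text \<open>
  Sacks products are \<open>\<omega>\<^sup>\<omega>\<close>-bounding in a strong sense, \<open>finite_capture\<close>: countably many open dense
  sets can be met simultaneously by finite sets that are predense below one condition \<open>q \<le> p\<close>. This
  is all that the theorem needs about the forcing (\<open>new_tree_if_finite_capture\<close>).

  Enumerate the family as \<open>T\<^sub>0, T\<^sub>1, \<dots>\<close>. Since \<open>f\<close> is forced not to be a branch of \<open>T\<^sub>n\<close>, it is dense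
  below \<open>p\<close> to decide an initial segment of \<open>f\<close> that has length at least \<open>n\<close> and has left \<open>T\<^sub>n\<close>. Capture
  these dense sets below \<open>q\<close> and let \<open>S\<close> be the tree of all finite sequences that some \<open>r \<le> q\<close> forces
  to be initial segments of \<open>f\<close>. For each \<open>n\<close>, every element of \<open>S\<close> is comparable with one of the
  finitely many segments captured at stage \<open>n\<close>. As these have length at least \<open>n\<close>, the \<open>n\<close>-th level of
  \<open>S\<close> is finite; as they lie outside of \<open>T\<^sub>n\<close>, every element of \<open>S \<inter> T\<^sub>n\<close> is an initial segment of one
  of them, so \<open>S \<inter> T\<^sub>n\<close> is finite.

  Finite capture of the Sacks product is a fusion argument (\<open>finite_capture_sacks\<close>). A stage freezes
  finitely many coordinates \<open>F\<close> up to a common height \<open>l\<close>. There are finitely many ways to choose a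
  node of height \<open>l\<close> in each of these coordinates; running through them and thinning out the trees
  above the chosen nodes moves all the corresponding restrictions into the given dense set without
  changing level \<open>l\<close> (\<open>dense_on_level_choices\<close>). These restrictions are predense because every branch
  of a tree passes through level \<open>l\<close>. The next height is chosen so large that every frozen node
  splits below it, which keeps the intersection of the trees perfect (\<open>perfect_tree_fusion\<close>).
\<close>

section \<open>Finite capture\<close>

definition preordered :: "'p forcing \<Rightarrow> bool" where
  "preordered P \<longleftrightarrow> (\<forall>r. leq P r r) \<and> (\<forall>r s t. leq P r s \<longrightarrow> leq P s t \<longrightarrow> leq P r t)"

definition open_dense_below :: "'p forcing \<Rightarrow> 'p \<Rightarrow> 'p set \<Rightarrow> bool" where
  "open_dense_below P p D \<longleftrightarrow>
     D \<subseteq> conds P \<and> (\<forall>r\<in>D. below P r \<subseteq> D) \<and> dense_below P p D"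

definition predense_below :: "'p forcing \<Rightarrow> 'p \<Rightarrow> 'p set \<Rightarrow> bool" where
  "predense_below P q X \<longleftrightarrow> (\<forall>r\<in>below P q. \<exists>x\<in>X. below P r \<inter> below P x \<noteq> {})"

definition finite_capture :: "'p forcing \<Rightarrow> bool" where
  "finite_capture P \<longleftrightarrow>
     (\<forall>p\<in>conds P. \<forall>D :: nat \<Rightarrow> 'p set. (\<forall>n. open_dense_below P p (D n)) \<longrightarrow>
        (\<exists>q\<in>below P p. \<forall>n. \<exists>X. finite X \<and> X \<subseteq> D n \<and> predense_below P q X))"

lemma below_trans:
  assumes "preordered P" "r \<in> below P q" "s \<in> below P r"
  shows "s \<in> below P q"
  using assms unfolding preordered_def below_def by blast

lemma below_refl: "preordered P \<Longrightarrow> p \<in> conds P \<Longrightarrow> p \<in> below P p"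
  unfolding preordered_def below_def by blast

lemma below_conds: "r \<in> below P q \<Longrightarrow> r \<in> conds P"
  unfolding below_def by blast

lemma dense_below_mono:
  assumes "preordered P" "dense_below P p D" "r \<in> below P p"
  shows "dense_below P r D"
  using assms(2) below_trans[OF assms(1,3)] unfolding dense_below_def by blast


section \<open>Approximations of a name for a real\<close>

definition forces_initial :: "'p forcing \<Rightarrow> ('i, 'p) name \<Rightarrow> nat list \<Rightarrow> 'p \<Rightarrow> bool" where
  "forces_initial P f t r \<longleftrightarrow> (\<forall>k<length t. f_value P f k (t ! k) r)"

text \<open>Membership in \<open>[T]\<close> becomes a density statement about conditions that decide an entire initial
  segment, which is the only form in which branches are used.\<close>

lemma f_branch_iff:
  "f_branch P f T p \<longleftrightarrow>
     (\<forall>n. dense_below P p {r. \<exists>t\<in>T. length t = n \<and> forces_initial P f t r})"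
proof -
  have "{r. \<exists>t\<in>{t \<in> T. length t = n}. \<forall>k\<in>{..<n}. f_value P f k (t ! k) r} =
      {r. \<exists>t\<in>T. length t = n \<and> forces_initial P f t r}" for n
    unfolding forces_initial_def by auto
  then show ?thesis unfolding f_branch_def f_all_def f_ex_def by simp
qed

lemma f_value_mono:
  assumes "preordered P" "f_value P f k m p" "r \<in> below P p"
  shows "f_value P f k m r"
  using assms(2) unfolding f_value_def forces_mem_def
  by (rule dense_below_mono[OF assms(1) _ assms(3)])

lemma forces_initial_mono:
  assumes "preordered P" "forces_initial P f t p" "r \<in> below P p"
  shows "forces_initial P f t r"
  using assms(2) f_value_mono[OF assms(1) _ assms(3)] unfolding forces_initial_def by blast

lemma forces_initial_prefix:
  assumes "forces_initial P f t r" "prefix s t"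
  shows "forces_initial P f s r"
proof -
  obtain u where u: "t = s @ u" using assms(2) by (auto simp: prefix_def)
  have "f_value P f k (s ! k) r" if "k < length s" for k
    using assms(1)[unfolded forces_initial_def, rule_format, of k] that
    by (simp add: u nth_append)
  then show ?thesis unfolding forces_initial_def by blast
qed

text \<open>The functionality clause of \<open>f_real\<close> provides, densely, a value together with the information that
  no stronger condition forces another one. The next two lemmas derive existence and uniqueness of
  decided values from it, without any analysis of check names.\<close>

lemma f_value_decided:
  assumes "f_real P f one" "r \<in> below P one"
  obtains r' m where "r' \<in> below P r" "f_value P f k m r'"
    "\<And>m' r''. m' \<noteq> m \<Longrightarrow> r'' \<in> below P r' \<Longrightarrow> \<not> f_value P f k m' r''"
proof -
  have "f_ex P UNIV (\<lambda>m. f_and (f_value P f k m)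
      (f_all {m'. m' \<noteq> m} (\<lambda>m'. f_not P (f_value P f k m')))) one"
    using assms(1) unfolding f_real_def f_and_def f_all_def by blast
  then show ?thesis
    using assms(2) that unfolding f_ex_def dense_below_def f_and_def f_all_def f_not_def by blast
qed

lemma f_value_unique:
  assumes pre: "preordered P" and "f_real P f one" "r \<in> below P one"
    and "f_value P f k m r" "f_value P f k m' r"
  shows "m = m'"
proof -
  obtain r' m0 where r': "r' \<in> below P r"
    "\<And>m' r''. m' \<noteq> m0 \<Longrightarrow> r'' \<in> below P r' \<Longrightarrow> \<not> f_value P f k m' r''"
    by (rule f_value_decided[OF assms(2,3), of k]) (rule that)
  have "r' \<in> below P r'" by (rule below_refl[OF pre below_conds[OF r'(1)]])
  moreover have "f_value P f k m r'" "f_value P f k m' r'"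
    by (rule f_value_mono[OF pre _ r'(1)], fact)+
  ultimately have "m = m0" "m' = m0" using r'(2) by auto
  then show ?thesis by simp
qed

text \<open>Applied to a common extension of two conditions, this makes the segments decided by compatible
  conditions comparable.\<close>

lemma forces_initial_comparable:
  assumes "preordered P" "f_real P f one" "r \<in> below P one"
    and "forces_initial P f s r" "forces_initial P f t r" "length s \<le> length t"
  shows "prefix s t"
proof -
  have "s = take (length s) t"
  proof (rule nth_equalityI)
    show "length s = length (take (length s) t)" using assms(6) by simp
    fix k assume "k < length s"
    then have "f_value P f k (s ! k) r" "f_value P f k (t ! k) r" "take (length s) t ! k = t ! k"
      using assms(4-6) unfolding forces_initial_def by simp_all
    then show "s ! k = take (length s) t ! k"
      using f_value_unique[OF assms(1-3)] by metis
  qed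
  then show ?thesis by (metis take_is_prefix)
qed

lemma forces_initial_dense:
  assumes pre: "preordered P" and real: "f_real P f one" and r: "r \<in> below P one"
  shows "\<exists>r'\<in>below P r. \<exists>t. length t = n \<and> forces_initial P f t r'"
proof (induction n)
  case 0
  have "forces_initial P f [] r" by (simp add: forces_initial_def)
  then show ?case using below_refl[OF pre below_conds[OF r]] list.size(3) by metis
next
  case (Suc n)
  then obtain r1 t where r1: "r1 \<in> below P r" "length t = n" "forces_initial P f t r1" by blast
  obtain r2 m where r2: "r2 \<in> below P r1" "f_value P f n m r2"
    by (rule f_value_decided[OF real below_trans[OF pre r r1(1)], of n])
  have "forces_initial P f (t @ [m]) r2"
    using forces_initial_mono[OF pre r1(3) r2(1)] r2(2) r1(2)
    unfolding forces_initial_def by (auto simp: nth_append less_Suc_eq)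
  then show ?case
    using below_trans[OF pre r1(1) r2(1)] r1(2) by (metis length_append_singleton)
qed

text \<open>Some length \<open>k\<close> and some condition \<open>r\<^sub>1\<close> admit no extension that decides the segment of length \<open>k\<close>
  to be in \<open>T\<close>. So any longer segment decided below \<open>r\<^sub>1\<close> has already left \<open>T\<close>, and its length may be
  taken as large as desired.\<close>

lemma forces_initial_off_tree_dense:
  assumes pre: "preordered P" and real: "f_real P f one" and p: "p \<in> below P one"
    and T: "\<And>s t. t \<in> T \<Longrightarrow> prefix s t \<Longrightarrow> s \<in> T"
    and off: "f_not P (f_branch P f T) p"
  shows "open_dense_below P p
    {r \<in> conds P. \<exists>t. n \<le> length t \<and> t \<notin> T \<and> forces_initial P f t r}" (is "open_dense_below P p ?D")
  unfolding open_dense_below_def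
proof (intro conjI)
  show "?D \<subseteq> conds P" by blast
  show "\<forall>r\<in>?D. below P r \<subseteq> ?D"
  proof (intro ballI subsetI)
    fix r s assume r: "r \<in> ?D" and s: "s \<in> below P r"
    then obtain t where "n \<le> length t" "t \<notin> T" "forces_initial P f t r" by blast
    with forces_initial_mono[OF pre _ s] below_conds[OF s] show "s \<in> ?D" by blast
  qed
  show "dense_below P p ?D"
    unfolding dense_below_def
  proof
    fix r assume r: "r \<in> below P p"
    then have "\<not> f_branch P f T r" using off unfolding f_not_def by blast
    then obtain k r1 where r1: "r1 \<in> below P r"
      and no: "\<And>r2 t. r2 \<in> below P r1 \<Longrightarrow> t \<in> T \<Longrightarrow> length t = k \<Longrightarrow> \<not> forces_initial P f t r2"
      unfolding f_branch_iff dense_below_def by blast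
    have "r1 \<in> below P one" using below_trans[OF pre] p r r1 by blast
    then obtain r2 t where r2: "r2 \<in> below P r1" "length t = max n k" "forces_initial P f t r2"
      using forces_initial_dense[OF pre real] by blast
    have "take k t \<notin> T"
      using no[OF r2(1), of "take k t"] forces_initial_prefix[OF r2(3) take_is_prefix] r2(2) by auto
    then have "t \<notin> T" using T take_is_prefix by blast
    moreover have "n \<le> length t" using r2(2) by simp
    ultimately have "r2 \<in> ?D" using r2(3) below_conds[OF r2(1)] by blast
    then show "\<exists>r'\<in>below P r. r' \<in> ?D" using below_trans[OF pre r1 r2(1)] by blast
  qed
qed

text \<open>The tree consists of the segments decided below the capturing condition. The segments captured at
  stage \<open>n\<close> bound both its \<open>n\<close>-th level and its intersection with the \<open>n\<close>-th given tree.\<close>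

lemma new_tree_if_finite_capture:
  assumes pre: "preordered P" and cap: "finite_capture P"
    and cnt: "countable \<T>" and adfs: "adfs_family \<T>"
    and real: "f_real P f one" and p: "p \<in> below P one"
    and off: "\<And>T. T \<in> \<T> \<Longrightarrow> f_not P (f_branch P f T) p"
  shows "\<exists>S. \<exists>q\<in>below P p. fin_splitting_tree S \<and> adfs_family (\<T> \<union> {S}) \<and> f_branch P f S q"
proof -
  \<comment> \<open>The empty set is no tree, but it is closed under initial segments and has no branch; it
    makes the enumeration possible when the family is empty.\<close>
  define U where "U n = from_nat_into (insert {} \<T>) n" for n
  have U: "U n = {} \<or> U n \<in> \<T>" for n
    using from_nat_into[of "insert {} \<T>" n] unfolding U_def by blast
  have U_closed: "s \<in> U n" if "t \<in> U n" "prefix s t" for n s t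
    using U[of n] adfs that unfolding adfs_family_def fin_splitting_tree_def tree_def by blast
  have "f_not P (f_branch P f {}) p"
    unfolding f_not_def f_branch_iff dense_below_def
    using below_refl[OF pre below_conds] by blast
  then have U_off: "f_not P (f_branch P f (U n)) p" for n using U[of n] off by auto
  define D where "D n = {r \<in> conds P. \<exists>t. n \<le> length t \<and> t \<notin> U n \<and> forces_initial P f t r}" for n
  have "open_dense_below P p (D n)" for n
    unfolding D_def by (rule forces_initial_off_tree_dense[OF pre real p U_closed U_off])
  then obtain q X where q: "q \<in> below P p" and
    X: "\<And>n. finite (X n)" "\<And>n. X n \<subseteq> D n" "\<And>n. predense_below P q (X n)"
    using cap below_conds[OF p] unfolding finite_capture_def by metis
  have "\<forall>n. \<forall>x\<in>X n. \<exists>t. n \<le> length t \<and> t \<notin> U n \<and> forces_initial P f t x"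
    using X(2) unfolding D_def by blast
  then obtain w where w: "\<And>n x. x \<in> X n \<Longrightarrow> n \<le> length (w n x)"
    "\<And>n x. x \<in> X n \<Longrightarrow> w n x \<notin> U n" "\<And>n x. x \<in> X n \<Longrightarrow> forces_initial P f (w n x) x"
    by metis
  define S where "S = {s. \<exists>r\<in>below P q. forces_initial P f s r}"
  have q1: "r \<in> below P one" if "r \<in> below P q" for r
    using below_trans[OF pre] p q that by blast
  \<comment> \<open>A condition deciding \<open>s\<close> is compatible with a captured one, and a common extension decides both
    \<open>s\<close> and the segment captured there.\<close>
  have S_w: "\<exists>x\<in>X n. prefix s (w n x) \<or> prefix (w n x) s" if s: "s \<in> S" for s n
  proof -
    obtain r where r: "r \<in> below P q" "forces_initial P f s r" using s unfolding S_def by blast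
    then obtain x r' where x: "x \<in> X n" "r' \<in> below P r" "r' \<in> below P x"
      using X(3)[of n] unfolding predense_below_def by blast
    have "forces_initial P f s r'" "forces_initial P f (w n x) r'"
      using forces_initial_mono[OF pre] r x w(3) by blast+
    moreover have "r' \<in> below P one" using q1 below_trans[OF pre r(1) x(2)] by blast
    ultimately show ?thesis
      using forces_initial_comparable[OF pre real] x(1) by (meson linear)
  qed
  have S_level: "finite {s \<in> S. length s = n}" for n
  proof (rule finite_subset)
    show "{s \<in> S. length s = n} \<subseteq> (\<lambda>x. take n (w n x)) ` X n"
    proof
      fix s assume "s \<in> {s \<in> S. length s = n}"
      then obtain x where x: "x \<in> X n" "prefix s (w n x) \<or> prefix (w n x) s" and n: "length s = n"
        using S_w by blast
      have "length s \<le> length (w n x)" using w(1)[OF x(1)] n by simp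
      with x(2) have "s = take (length s) (w n x)" by (auto simp: prefix_def)
      then have "s = take n (w n x)" using n by simp
      then show "s \<in> (\<lambda>x. take n (w n x)) ` X n" using x(1) by blast
    qed
  qed (simp add: X(1))
  have S_dense: "\<exists>r'\<in>below P r. \<exists>t\<in>S. length t = n \<and> forces_initial P f t r'"
    if r: "r \<in> below P q" for r n
    using forces_initial_dense[OF pre real q1[OF r], of n] below_trans[OF pre r]
    unfolding S_def by blast
  have branch: "f_branch P f S q"
    using S_dense unfolding f_branch_iff dense_below_def by blast
  have "[] \<in> S"
    unfolding S_def mem_Collect_eq
    by (rule bexI[OF _ below_refl[OF pre below_conds[OF q]]]) (simp add: forces_initial_def)
  moreover have "s \<in> S" if t: "t \<in> S" "prefix s t" for s t
  proof -
    obtain r where "r \<in> below P q" "forces_initial P f t r" using t(1) unfolding S_def by blast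
    with forces_initial_prefix[OF _ t(2)] show ?thesis unfolding S_def mem_Collect_eq by metis
  qed
  ultimately have "tree S" unfolding tree_def by blast
  moreover have "{n. s @ [n] \<in> S} \<noteq> {}" if s: "s \<in> S" for s
  proof -
    obtain r where r: "r \<in> below P q" "forces_initial P f s r" using s unfolding S_def by blast
    obtain r' t where t: "r' \<in> below P r" "t \<in> S" "length t = Suc (length s)" "forces_initial P f t r'"
      using S_dense[OF r(1)] by blast
    have "prefix s t"
      using forces_initial_comparable[OF pre real _ forces_initial_mono[OF pre r(2) t(1)] t(4)] t(3)
        below_trans[OF pre q1[OF r(1)] t(1)] by simp
    then obtain u where u: "t = s @ u" by (auto simp: prefix_def)
    then obtain n where "u = [n]" using t(3) by (auto simp: length_Suc_conv)
    then show ?thesis using u t(2) by blast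
  qed
  moreover have "finite {n. s @ [n] \<in> S}" for s
  proof (rule finite_imageD)
    show "finite ((\<lambda>n. s @ [n]) ` {n. s @ [n] \<in> S})"
      by (rule finite_subset[OF _ S_level[of "Suc (length s)"]]) auto
  qed (simp add: inj_on_def)
  ultimately have fin: "fin_splitting_tree S" unfolding fin_splitting_tree_def by blast
  have "finite (S \<inter> T)" if T: "T \<in> \<T>" for T
  proof -
    obtain n where n: "U n = T"
      using from_nat_into_surj[of "insert {} \<T>" T] cnt T unfolding U_def by auto
    define N where "N = Max (insert 0 ((\<lambda>x. length (w n x)) ` X n))"
    have N: "length (w n x) \<le> N" if "x \<in> X n" for x
      unfolding N_def using X(1) that by simp
    have "S \<inter> T \<subseteq> (\<Union>k\<le>N. {s \<in> S. length s = k})"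
    proof
      fix s assume s: "s \<in> S \<inter> T"
      then obtain x where x: "x \<in> X n" "prefix s (w n x) \<or> prefix (w n x) s"
        using S_w by blast
      have "\<not> prefix (w n x) s" using w(2)[OF x(1)] U_closed s n by blast
      then have "length s \<le> N" using x N[OF x(1)] prefix_length_le by fastforce
      then show "s \<in> (\<Union>k\<le>N. {s \<in> S. length s = k})" using s by blast
    qed
    then show ?thesis using S_level by (meson finite_UN_I finite_atMost finite_subset)
  qed
  then have "adfs_family (\<T> \<union> {S})"
    using adfs fin unfolding adfs_family_def by (auto simp: Int_commute)
  then show ?thesis using fin branch q by blast
qed


section \<open>Perfect trees\<close>

lemma perfect_tree_extend:
  assumes "perfect_tree T" "s \<in> T" "length s \<le> n"
  shows "\<exists>t\<in>T. prefix s t \<and> length t = n"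
  using assms(3)
proof (induction rule: dec_induct)
  case base
  then show ?case using assms(2) by blast
next
  case (step n)
  then obtain t where t: "t \<in> T" "prefix s t" "length t = n" by blast
  then obtain u where u: "prefix t u" "u @ [False] \<in> T"
    using assms(1) unfolding perfect_tree_def by blast
  have "take (Suc n) (u @ [False]) \<in> T"
    using u(2) assms(1) take_is_prefix unfolding perfect_tree_def tree_def by blast
  moreover have "prefix s (take (Suc n) (u @ [False]))"
    using t u by (auto simp: prefix_def)
  moreover have "length (take (Suc n) (u @ [False])) = Suc n"
    using t u prefix_length_le[of t u] by simp
  ultimately show ?case by blast
qed

lemma perfect_tree_Nil: "perfect_tree T \<Longrightarrow> [] \<in> T"
  unfolding perfect_tree_def tree_def by (metis Nil_prefix ex_in_conv)

lemma perfect_tree_prefix: "perfect_tree T \<Longrightarrow> t \<in> T \<Longrightarrow> prefix s t \<Longrightarrow> s \<in> T"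
  unfolding perfect_tree_def tree_def by blast

lemma perfect_tree_UNIV: "perfect_tree UNIV"
  unfolding perfect_tree_def tree_def by auto

definition cone :: "'a list set \<Rightarrow> 'a list \<Rightarrow> 'a list set" where
  "cone T a = {s \<in> T. prefix s a \<or> prefix a s}"

lemma cone_subset: "cone T a \<subseteq> T"
  unfolding cone_def by blast

lemma cone_mono: "S \<subseteq> T \<Longrightarrow> cone S a \<subseteq> cone T a"
  unfolding cone_def by blast

lemma perfect_tree_cone:
  assumes T: "perfect_tree T" and a: "a \<in> T"
  shows "perfect_tree (cone T a)"
  unfolding perfect_tree_def
proof (intro conjI ballI)
  show "tree (cone T a)"
    using a perfect_tree_prefix[OF T] prefix_order.trans prefix_same_cases
    unfolding tree_def cone_def by blast
  fix s assume s: "s \<in> cone T a"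
  define s' where "s' = (if prefix s a then a else s)"
  have s': "s' \<in> T" "prefix s s'" "prefix a s'" using s a unfolding s'_def cone_def by auto
  then obtain t where "t \<in> T" "prefix s' t" "t @ [False] \<in> T" "t @ [True] \<in> T"
    using T unfolding perfect_tree_def by blast
  then show "\<exists>t\<in>cone T a. prefix s t \<and> t @ [False] \<in> cone T a \<and> t @ [True] \<in> cone T a"
    using s' unfolding cone_def by (intro bexI[of _ t]) (auto intro: prefix_order.trans)
qed

text \<open>Any node of \<open>R\<close> at the height of \<open>a\<close> is comparable with \<open>a\<close>, hence equal to it. Shrinking a tree
  above \<open>a\<close> therefore cannot remove \<open>a\<close> itself.\<close>

lemma perfect_subtree_of_cone:
  assumes "perfect_tree R" "R \<subseteq> cone T a"
  shows "a \<in> R"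
proof -
  obtain t where t: "t \<in> R" "length t = length a"
    using perfect_tree_extend[OF assms(1) perfect_tree_Nil[OF assms(1)], of "length a"] by auto
  then have "prefix t a \<or> prefix a t" using assms(2) unfolding cone_def by blast
  then have "t = a" using t(2) by (auto simp: prefix_def)
  then show ?thesis using t(1) by simp
qed

text \<open>This is \<open>T\<close> with the part above \<open>a\<close> replaced by the corresponding part of \<open>R\<close>, for \<open>R\<close> a perfect
  subtree of \<open>cone T a\<close>: the remaining nodes of such an \<open>R\<close> are initial segments of \<open>a\<close>.\<close>

definition graft :: "'a list set \<Rightarrow> 'a list \<Rightarrow> 'a list set \<Rightarrow> 'a list set" where
  "graft T a R = {s \<in> T. \<not> prefix a s} \<union> R"

lemma perfect_tree_graft:
  assumes T: "perfect_tree T" and R: "perfect_tree R" "R \<subseteq> cone T a"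
  shows "perfect_tree (graft T a R)"
  unfolding perfect_tree_def
proof (intro conjI ballI)
  have a: "a \<in> R" using perfect_subtree_of_cone[OF R] .
  show "tree (graft T a R)"
    using a perfect_tree_prefix[OF T] perfect_tree_prefix[OF R(1)] prefix_order.trans
    unfolding tree_def graft_def by blast
  fix s assume s: "s \<in> graft T a R"
  show "\<exists>t\<in>graft T a R. prefix s t \<and> t @ [False] \<in> graft T a R \<and> t @ [True] \<in> graft T a R"
  proof (cases "s \<in> R")
    case True
    then show ?thesis using R(1) unfolding perfect_tree_def graft_def by blast
  next
    case False
    then have s': "s \<in> T" "\<not> prefix a s" "\<not> prefix s a"
      using s a perfect_tree_prefix[OF R(1)] unfolding graft_def by blast+
    then have off: "\<not> prefix a u" if "prefix s u" for u
      using that prefix_same_cases by blast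
    obtain t where t: "t \<in> T" "prefix s t" "t @ [False] \<in> T" "t @ [True] \<in> T"
      using T s'(1) unfolding perfect_tree_def by blast
    then have "prefix s (t @ [b])" for b by simp
    then show ?thesis using t off unfolding graft_def by blast
  qed
qed

lemma graft_subset: "R \<subseteq> cone T a \<Longrightarrow> graft T a R \<subseteq> T"
  unfolding graft_def cone_def by blast

lemma cone_graft:
  assumes "perfect_tree R" "R \<subseteq> cone T a"
  shows "cone (graft T a R) a \<subseteq> R"
  using perfect_subtree_of_cone[OF assms] perfect_tree_prefix[OF assms(1)]
  unfolding cone_def graft_def by blast

lemma graft_level:
  assumes "perfect_tree R" "R \<subseteq> cone T a" "s \<in> T" "length s = length a"
  shows "s \<in> graft T a R"
proof (cases "s = a")
  case True
  then show ?thesis using perfect_subtree_of_cone[OF assms(1,2)] unfolding graft_def by blast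
next
  case False
  then have "\<not> prefix a s" using assms(4) by (auto simp: prefix_def)
  then show ?thesis using assms(3) unfolding graft_def by blast
qed

lemma finite_level: "finite {a \<in> T. length (a :: bool list) = l}"
  using finite_lists_length_eq[of "UNIV :: bool set" l] by (rule finite_subset[rotated]) auto

text \<open>The bound \<open>l'\<close> is on the splitting node, so that its two successors have height at most \<open>l'\<close> and
  are preserved once level \<open>l'\<close> is frozen.\<close>

definition splits_between :: "bool list set \<Rightarrow> nat \<Rightarrow> nat \<Rightarrow> bool" where
  "splits_between T l l' \<longleftrightarrow>
     (\<forall>a\<in>T. length a = l \<longrightarrow>
        (\<exists>t. prefix a t \<and> length t < l' \<and> t @ [False] \<in> T \<and> t @ [True] \<in> T))"

lemma splits_between_mono: "splits_between T l m \<Longrightarrow> m \<le> m' \<Longrightarrow> splits_between T l m'"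
  unfolding splits_between_def by (meson order_less_le_trans)

lemma ex_splits_between:
  assumes "perfect_tree T"
  shows "\<exists>m. splits_between T l m"
proof -
  have "\<forall>a\<in>T. \<exists>t. prefix a t \<and> t @ [False] \<in> T \<and> t @ [True] \<in> T"
    using assms unfolding perfect_tree_def by blast
  then obtain t where t: "\<And>a. a \<in> T \<Longrightarrow> prefix a (t a) \<and> t a @ [False] \<in> T \<and> t a @ [True] \<in> T"
    by metis
  define m where "m = Suc (Max (length ` t ` {a \<in> T. length a = l}))"
  have "length (t a) < m" if "a \<in> T" "length a = l" for a
    unfolding m_def using that finite_level[of T l] by (intro le_imp_less_Suc Max_ge) auto
  then show ?thesis using t unfolding splits_between_def by blast
qed

lemma ex_common_splits_between:
  assumes "finite F" "\<And>i. i \<in> F \<Longrightarrow> perfect_tree (p i)"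
  shows "\<exists>m>l. \<forall>i\<in>F. splits_between (p i) l m"
proof -
  have "\<forall>i\<in>F. \<exists>m. splits_between (p i) l m" using ex_splits_between assms(2) by blast
  then obtain m where m: "\<And>i. i \<in> F \<Longrightarrow> splits_between (p i) l (m i)" by metis
  define M where "M = Suc (max l (Max (m ` F)))"
  have "m i \<le> M" if "i \<in> F" for i
    unfolding M_def using assms(1) that by (intro le_SucI max.coboundedI2 Max_ge) auto
  then have "\<forall>i\<in>F. splits_between (p i) l M" using m splits_between_mono by blast
  moreover have "l < M" unfolding M_def by simp
  ultimately show ?thesis by blast
qed


section \<open>Fusion in the countable support product\<close>

definition support :: "'l set \<Rightarrow> ('l \<Rightarrow> bool list set) \<Rightarrow> 'l set" where
  "support L p = {i \<in> L. p i \<noteq> UNIV}"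

lemma sacks_conds_iff:
  "p \<in> conds (sacks_product L) \<longleftrightarrow>
     (\<forall>i\<in>L. perfect_tree (p i)) \<and> (\<forall>i. i \<notin> L \<longrightarrow> p i = undefined) \<and> countable (support L p)"
  unfolding sacks_product_def support_def by (auto simp: PiE_def Pi_def extensional_def)

lemma sacks_leq_iff: "leq (sacks_product L) q p \<longleftrightarrow> (\<forall>i\<in>L. q i \<subseteq> p i)"
  unfolding sacks_product_def by simp

lemma preordered_sacks: "preordered (sacks_product L)"
  unfolding preordered_def sacks_leq_iff by blast

lemma sacks_perfect: "p \<in> conds (sacks_product L) \<Longrightarrow> i \<in> L \<Longrightarrow> perfect_tree (p i)"
  unfolding sacks_conds_iff by blast

lemma support_mono: "\<forall>i\<in>L. q i \<subseteq> p i \<Longrightarrow> support L p \<subseteq> support L q"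
  unfolding support_def by blast

definition refine :: "('l \<Rightarrow> bool list set) \<Rightarrow> 'l set \<Rightarrow> ('l \<Rightarrow> bool list) \<Rightarrow> 'l \<Rightarrow> bool list set" where
  "refine p F \<sigma> = (\<lambda>i. if i \<in> F then cone (p i) (\<sigma> i) else p i)"

lemma refine_subset: "refine p F \<sigma> i \<subseteq> p i"
  unfolding refine_def using cone_subset by auto

lemma refine_mono: "q i \<subseteq> p i \<Longrightarrow> refine q F \<sigma> i \<subseteq> refine p F \<sigma> i"
  unfolding refine_def using cone_mono[of "q i" "p i" "\<sigma> i"] by simp

lemma refine_conds:
  assumes p: "p \<in> conds (sacks_product L)" and F: "finite F" "F \<subseteq> L"
    and \<sigma>: "\<And>i. i \<in> F \<Longrightarrow> \<sigma> i \<in> p i"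
  shows "refine p F \<sigma> \<in> conds (sacks_product L)"
proof -
  have "support L (refine p F \<sigma>) \<subseteq> F \<union> support L p"
    unfolding support_def refine_def by auto
  then have "countable (support L (refine p F \<sigma>))"
    using p F(1) unfolding sacks_conds_iff
    by (meson countable_Un countable_finite countable_subset)
  then show ?thesis
    using p F(2) \<sigma> perfect_tree_cone unfolding sacks_conds_iff refine_def by auto
qed

abbreviation level_choices :: "('l \<Rightarrow> bool list set) \<Rightarrow> 'l set \<Rightarrow> nat \<Rightarrow> ('l \<Rightarrow> bool list) set" where
  "level_choices p F l \<equiv> PiE F (\<lambda>i. {a \<in> p i. length a = l})"

lemma finite_level_choices: "finite F \<Longrightarrow> finite (level_choices p F l)"
  by (rule finite_PiE) (simp_all add: finite_level)

text \<open>A condition below \<open>p\<close> has a node of height \<open>l\<close> in each coordinate of \<open>F\<close>. Restricting both it and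
  \<open>p\<close> to these nodes exhibits a common extension.\<close>

lemma predense_level_choices:
  assumes p: "p \<in> conds (sacks_product L)" and F: "finite F" "F \<subseteq> L"
  shows "predense_below (sacks_product L) p (refine p F ` level_choices p F l)"
  unfolding predense_below_def
proof
  fix r assume "r \<in> below (sacks_product L) p"
  then have r: "r \<in> conds (sacks_product L)" "\<forall>i\<in>L. r i \<subseteq> p i"
    unfolding below_def sacks_leq_iff by auto
  have "\<forall>i\<in>F. \<exists>a\<in>r i. length a = l"
    using perfect_tree_extend[OF sacks_perfect[OF r(1)] perfect_tree_Nil[OF sacks_perfect[OF r(1)]]] F(2)
    by fastforce
  then obtain \<sigma>0 where "\<And>i. i \<in> F \<Longrightarrow> \<sigma>0 i \<in> r i \<and> length (\<sigma>0 i) = l" by metis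
  then obtain \<sigma> where \<sigma>: "\<sigma> \<in> level_choices r F l"
    by (intro that[of "restrict \<sigma>0 F"]) simp
  then have "refine r F \<sigma> \<in> conds (sacks_product L)"
    by (intro refine_conds[OF r(1) F]) auto
  then have "refine r F \<sigma> \<in> below (sacks_product L) r \<inter> below (sacks_product L) (refine p F \<sigma>)"
    using r(2) refine_subset[of r F \<sigma>] refine_mono[of r _ p F \<sigma>]
    unfolding below_def sacks_leq_iff by simp
  moreover have "\<sigma> \<in> level_choices p F l" using \<sigma> r(2) F(2) by (auto simp: PiE_def Pi_def)
  ultimately show "\<exists>x\<in>refine p F ` level_choices p F l.
      below (sacks_product L) r \<inter> below (sacks_product L) x \<noteq> {}" by blast
qed

text \<open>The finitely many choices of nodes are handled one after the other. For a choice \<open>\<sigma>\<close>, an extension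
  \<open>r \<in> D\<close> of the restriction to \<open>\<sigma>\<close> is grafted back above the nodes of \<open>\<sigma>\<close> in the coordinates of \<open>F\<close>,
  and adopted outright in the others. Grafting does not change level \<open>l\<close>, and the choices handled
  before stay in \<open>D\<close> because \<open>D\<close> is open.\<close>

lemma dense_on_level_choices:
  assumes p: "p \<in> conds (sacks_product L)" and F: "finite F" "F \<subseteq> L"
    and D: "open_dense_below (sacks_product L) p D"
  shows "\<exists>p'\<in>below (sacks_product L) p.
    (\<forall>i\<in>F. \<forall>a\<in>p i. length a = l \<longrightarrow> a \<in> p' i) \<and> (\<forall>\<sigma>\<in>level_choices p F l. refine p' F \<sigma> \<in> D)"
proof -
  let ?P = "sacks_product L"
  have open_D: "s \<in> D" if "r \<in> D" "s \<in> conds ?P" "\<forall>i\<in>L. s i \<subseteq> r i" for r s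
    using D that unfolding open_dense_below_def below_def sacks_leq_iff by blast
  have "\<exists>p'\<in>below ?P p. (\<forall>i\<in>F. \<forall>a\<in>p i. length a = l \<longrightarrow> a \<in> p' i) \<and> (\<forall>\<sigma>\<in>\<Sigma>. refine p' F \<sigma> \<in> D)"
    if "finite \<Sigma>" "\<Sigma> \<subseteq> level_choices p F l" for \<Sigma>
    using that
  proof (induction \<Sigma> rule: finite_induct)
    case empty
    then show ?case using below_refl[OF preordered_sacks p] by blast
  next
    case (insert \<sigma> \<Sigma>)
    then obtain p1 where p1: "p1 \<in> conds ?P" "\<forall>i\<in>L. p1 i \<subseteq> p i"
      "\<And>i a. i \<in> F \<Longrightarrow> a \<in> p i \<Longrightarrow> length a = l \<Longrightarrow> a \<in> p1 i"
      "\<And>\<tau>. \<tau> \<in> \<Sigma> \<Longrightarrow> refine p1 F \<tau> \<in> D"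
      unfolding below_def sacks_leq_iff by blast
    have \<sigma>: "\<sigma> i \<in> p1 i" "length (\<sigma> i) = l" if "i \<in> F" for i
      using insert.prems p1(3) that by (auto simp: PiE_def Pi_def)
    have "refine p1 F \<sigma> \<in> below ?P p"
      using refine_conds[OF p1(1) F \<sigma>(1)] refine_subset[of p1 F \<sigma>] p1(2)
      unfolding below_def sacks_leq_iff by blast
    then obtain r where r: "r \<in> D" "r \<in> conds ?P" "\<forall>i\<in>L. r i \<subseteq> refine p1 F \<sigma> i"
      using D unfolding open_dense_below_def dense_below_def below_def sacks_leq_iff by blast
    have r_cone: "r i \<subseteq> cone (p1 i) (\<sigma> i)" "perfect_tree (r i)" if "i \<in> F" for i
      using r(2,3) that F(2) sacks_perfect unfolding refine_def by fastforce+
    define p2 where "p2 = (\<lambda>i. if i \<in> F then graft (p1 i) (\<sigma> i) (r i) else r i)"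
    have p2_p1: "p2 i \<subseteq> p1 i" if "i \<in> L" for i
    proof (cases "i \<in> F")
      case True
      then show ?thesis using graft_subset[OF r_cone(1)] unfolding p2_def by simp
    next
      case False
      then show ?thesis using r(3) that refine_subset[of p1 F \<sigma> i] unfolding p2_def by auto
    qed
    have p2_level: "a \<in> p2 i" if "i \<in> F" "a \<in> p i" "length a = l" for i a
      using graft_level[OF r_cone(2,1)] p1(3) \<sigma>(2) that unfolding p2_def by simp
    have "support L p2 \<subseteq> F \<union> support L r" unfolding support_def p2_def by auto
    then have "countable (support L p2)"
      using r(2) F(1) unfolding sacks_conds_iff
      by (meson countable_Un countable_finite countable_subset)
    then have p2: "p2 \<in> conds ?P"
      using r(2) r_cone perfect_tree_graft[OF sacks_perfect[OF p1(1)]] F(2)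
      unfolding sacks_conds_iff p2_def by auto
    have ref_conds: "refine p2 F \<tau> \<in> conds ?P" if "\<tau> \<in> level_choices p F l" for \<tau>
      using that p2_level by (intro refine_conds[OF p2 F]) (auto simp: PiE_def Pi_def)
    have "refine p2 F \<tau> \<in> D" if \<tau>: "\<tau> \<in> insert \<sigma> \<Sigma>" for \<tau>
    proof -
      have cond: "refine p2 F \<tau> \<in> conds ?P" using \<tau> insert.prems ref_conds by blast
      show ?thesis
      proof (cases "\<tau> = \<sigma>")
        case True
        have "refine p2 F \<sigma> i \<subseteq> r i" for i
          using cone_graft r_cone unfolding refine_def p2_def by auto
        then show ?thesis using open_D[OF r(1) cond] True by simp
      next
        case False
        then have "refine p1 F \<tau> \<in> D" using \<tau> p1(4) by blast
        moreover have "\<forall>i\<in>L. refine p2 F \<tau> i \<subseteq> refine p1 F \<tau> i"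
          using refine_mono[of p2 _ p1 F \<tau>] p2_p1 by simp
        ultimately show ?thesis by (rule open_D[OF _ cond])
      qed
    qed
    moreover have "p2 \<in> below ?P p"
      using p2 p2_p1 p1(2) unfolding below_def sacks_leq_iff by blast
    ultimately show ?case by (intro bexI[of _ p2] conjI ballI impI p2_level)
  qed
  from this[OF finite_level_choices[OF F(1)] subset_refl] show ?thesis .
qed

text \<open>
  A fusion state \<open>(p, F, l, h)\<close> consists of the current condition \<open>p\<close>, the finite set \<open>F\<close> of frozen
  coordinates, the height \<open>l\<close> up to which they are frozen, and a bookkeeping function \<open>h\<close>. New
  coordinates may enter the support at every stage, infinitely many at a time, so no enumeration of
  the final support is available in advance. Instead, a coordinate \<open>i\<close> receives a deadline \<open>h i\<close> when
  it enters the support: it is frozen at the latest at stage \<open>h i\<close>, or on entry if that is later.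
  Finiteness of \<open>{i. h i \<le> k}\<close> within the support keeps \<open>F\<close> finite.
\<close>

definition fusion_stage ::
  "'l set \<Rightarrow> ('l \<Rightarrow> bool list set) \<Rightarrow> nat \<Rightarrow>
    ('l \<Rightarrow> bool list set) \<times> 'l set \<times> nat \<times> ('l \<Rightarrow> nat) \<Rightarrow> bool" where
  "fusion_stage L p0 n = (\<lambda>(p, F, l, h).
     p \<in> below (sacks_product L) p0 \<and> finite F \<and> F \<subseteq> L \<and>
     {i \<in> support L p. h i \<le> n} \<subseteq> F \<and> (\<forall>k. finite {i \<in> support L p. h i \<le> k}))"

definition fusion_step ::
  "'l set \<Rightarrow> ('l \<Rightarrow> bool list set) set \<Rightarrow>
    ('l \<Rightarrow> bool list set) \<times> 'l set \<times> nat \<times> ('l \<Rightarrow> nat) \<Rightarrow>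
    ('l \<Rightarrow> bool list set) \<times> 'l set \<times> nat \<times> ('l \<Rightarrow> nat) \<Rightarrow> bool" where
  "fusion_step L D = (\<lambda>(p, F, l, h) (p', F', l', h').
     p' \<in> below (sacks_product L) p \<and> F \<subseteq> F' \<and> l < l' \<and>
     (\<forall>i\<in>support L p. h' i = h i) \<and>
     (\<forall>i\<in>F. (\<forall>a\<in>p i. length a = l \<longrightarrow> a \<in> p' i) \<and> splits_between (p' i) l l') \<and>
     (\<forall>\<sigma>\<in>level_choices p F l. refine p' F \<sigma> \<in> D))"

lemma finite_small_codes:
  assumes "countable A"
  shows "finite {i \<in> A. to_nat_on A i \<le> k}"
proof (rule finite_imageD)
  show "finite (to_nat_on A ` {i \<in> A. to_nat_on A i \<le> k})"
    by (rule finite_subset[of _ "{..k}"]) auto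
  show "inj_on (to_nat_on A) {i \<in> A. to_nat_on A i \<le> k}"
    using inj_on_to_nat_on[OF assms] by (rule inj_on_subset) auto
qed

lemma fusion_stage_0:
  assumes p: "p \<in> conds (sacks_product L)"
  shows "\<exists>x. fusion_stage L p 0 x"
proof -
  let ?h = "to_nat_on (support L p)"
  have fin: "finite {i \<in> support L p. ?h i \<le> k}" for k
    using p finite_small_codes unfolding sacks_conds_iff by blast
  have "fusion_stage L p 0 (p, {i \<in> support L p. ?h i \<le> 0}, 0, ?h)"
    using fin[of 0] fin below_refl[OF preordered_sacks p]
    unfolding fusion_stage_def by (auto simp: support_def)
  then show ?thesis by blast
qed

lemma fusion_step_exists:
  assumes stage: "fusion_stage L p0 n x" and D: "open_dense_below (sacks_product L) p0 D"
  shows "\<exists>y. fusion_stage L p0 (Suc n) y \<and> fusion_step L D x y"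
proof -
  obtain p F l h where x: "x = (p, F, l, h)" by (cases x)
  have p: "p \<in> below (sacks_product L) p0" and F: "finite F" "F \<subseteq> L"
    and h: "\<And>k. finite {i \<in> support L p. h i \<le> k}"
    using stage unfolding fusion_stage_def x by auto
  have "open_dense_below (sacks_product L) p D"
    using D dense_below_mono[OF preordered_sacks _ p] unfolding open_dense_below_def by blast
  then obtain p' where p': "p' \<in> below (sacks_product L) p"
    "\<forall>i\<in>F. \<forall>a\<in>p i. length a = l \<longrightarrow> a \<in> p' i" "\<forall>\<sigma>\<in>level_choices p F l. refine p' F \<sigma> \<in> D"
    using dense_on_level_choices[OF below_conds[OF p] F] by blast
  obtain l' where l': "l < l'" "\<forall>i\<in>F. splits_between (p' i) l l'"
    using ex_common_splits_between[OF F(1), of p' l] sacks_perfect[OF below_conds[OF p'(1)]] F(2)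
    by blast
  define h' where "h' i = (if i \<in> support L p then h i else to_nat_on (support L p') i)" for i
  have "{i \<in> support L p'. h' i \<le> k} \<subseteq> {i \<in> support L p. h i \<le> k} \<union>
      {i \<in> support L p'. to_nat_on (support L p') i \<le> k}" for k
    unfolding h'_def by auto
  moreover have "countable (support L p')" using below_conds[OF p'(1)] unfolding sacks_conds_iff by blast
  ultimately have h'_fin: "finite {i \<in> support L p'. h' i \<le> k}" for k
    by (rule finite_subset[OF _ finite_UnI[OF h finite_small_codes]])
  define F' where "F' = F \<union> {i \<in> support L p'. h' i \<le> Suc n}"
  have "F' \<subseteq> L" using F(2) unfolding F'_def support_def by blast
  then have "fusion_stage L p0 (Suc n) (p', F', l', h')"
    using below_trans[OF preordered_sacks p p'(1)] F(1) h'_fin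
    unfolding fusion_stage_def F'_def by auto
  moreover have "fusion_step L D x (p', F', l', h')"
    using p' l' unfolding fusion_step_def x F'_def h'_def by auto
  ultimately show ?thesis by blast
qed

text \<open>Here \<open>m\<close> is the stage from which on the coordinate is frozen. A node present at stage \<open>n \<ge> m\<close> at
  height at most \<open>l n\<close> survives to the intersection, so an element \<open>s\<close> of the intersection can be
  extended within \<open>T (Suc n)\<close> to a splitting node below height \<open>l (Suc n)\<close> whose successors survive.\<close>

lemma perfect_tree_fusion:
  fixes T :: "nat \<Rightarrow> bool list set"
  assumes T: "\<And>n. perfect_tree (T n)" and dec: "\<And>n. T (Suc n) \<subseteq> T n"
    and l: "\<And>n. l n < l (Suc n)"
    and keep: "\<And>n a. m \<le> n \<Longrightarrow> a \<in> T n \<Longrightarrow> length a = l n \<Longrightarrow> a \<in> T (Suc n)"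
    and split: "\<And>n. m \<le> n \<Longrightarrow> splits_between (T (Suc n)) (l n) (l (Suc n))"
  shows "perfect_tree (\<Inter>n. T n)"
proof -
  have anti: "T n' \<subseteq> T n" if "n \<le> n'" for n n' using lift_Suc_antimono_le[of T] dec that by blast
  have mono: "l n \<le> l n'" if "n \<le> n'" for n n'
    using lift_Suc_mono_le[of l n n'] l that by (meson order_less_imp_le)
  have big: "n \<le> l n" for n
    using l by (induction n) (auto simp: Suc_le_eq intro: le_less_trans)
  have keep1: "a \<in> T (Suc n)" if "m \<le> n" "a \<in> T n" "length a \<le> l n" for a n
    using perfect_tree_extend[OF T that(2,3)] keep[OF that(1)] perfect_tree_prefix[OF T] by blast
  have stay: "a \<in> T (n + k)" if "m \<le> n" "a \<in> T n" "length a \<le> l n" for a n k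
  proof (induction k)
    case (Suc k)
    then show ?case using keep1[of "n + k" a] mono[of n "n + k"] that by simp
  qed (use that in simp)
  have lim: "a \<in> (\<Inter>n. T n)" if "m \<le> n" "a \<in> T n" "length a \<le> l n" for a n
  proof
    fix k
    show "a \<in> T k" using stay[OF that, of k] anti[of k "n + k"] by auto
  qed
  show ?thesis
    unfolding perfect_tree_def
  proof (intro conjI ballI)
    show "tree (\<Inter>n. T n)"
      using perfect_tree_Nil[OF T] perfect_tree_prefix[OF T] unfolding tree_def by blast
    fix s assume s: "s \<in> (\<Inter>n. T n)"
    define n where "n = max m (length s)"
    have "s \<in> T (Suc n)" "length s \<le> l n" "m \<le> n" using s big[of n] unfolding n_def by auto
    then obtain a where a: "a \<in> T (Suc n)" "prefix s a" "length a = l n"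
      using perfect_tree_extend[OF T] by blast
    then obtain t where t: "prefix a t" "length t < l (Suc n)"
      "t @ [False] \<in> T (Suc n)" "t @ [True] \<in> T (Suc n)"
      using split[OF \<open>m \<le> n\<close>] unfolding splits_between_def by blast
    have "t @ [False] \<in> (\<Inter>n. T n)" "t @ [True] \<in> (\<Inter>n. T n)"
      using lim[of "Suc n"] t \<open>m \<le> n\<close> by simp_all
    moreover from this(2) have "t \<in> (\<Inter>n. T n)"
      using perfect_tree_prefix[OF T, of "t @ [True]" _ t] by simp
    ultimately show "\<exists>t\<in>\<Inter>n. T n. prefix s t \<and> t @ [False] \<in> (\<Inter>n. T n) \<and> t @ [True] \<in> (\<Inter>n. T n)"
      using prefix_order.trans[OF a(2) t(1)] by blast
  qed
qed

theorem finite_capture_sacks: "finite_capture (sacks_product L)"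
  unfolding finite_capture_def
proof (intro ballI allI impI)
  let ?P = "sacks_product L"
  fix p0 and D :: "nat \<Rightarrow> ('a \<Rightarrow> bool list set) set"
  assume p0: "p0 \<in> conds ?P" and D: "\<forall>n. open_dense_below ?P p0 (D n)"
  obtain x where x: "\<And>n. fusion_stage L p0 n (x n)" "\<And>n. fusion_step L (D n) (x n) (x (Suc n))"
    using dependent_nat_choice[of "fusion_stage L p0" "\<lambda>n. fusion_step L (D n)"]
      fusion_stage_0[OF p0] fusion_step_exists D by metis
  define p F l h where "p n = fst (x n)" and "F n = fst (snd (x n))"
    and "l n = fst (snd (snd (x n)))" and "h n = snd (snd (snd (x n)))" for n
  have x_eq: "x n = (p n, F n, l n, h n)" for n
    unfolding p_def F_def l_def h_def by simp
  have p: "p n \<in> conds ?P" "\<forall>i\<in>L. p n i \<subseteq> p0 i"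
    and F: "finite (F n)" "F n \<subseteq> L" "\<And>i. i \<in> support L (p n) \<Longrightarrow> h n i \<le> n \<Longrightarrow> i \<in> F n" for n
    using x(1)[of n] unfolding fusion_stage_def x_eq by (auto simp: below_def sacks_leq_iff)
  have p_dec: "i \<in> L \<Longrightarrow> p (Suc n) i \<subseteq> p n i" and F_inc: "F n \<subseteq> F (Suc n)"
    and l_inc: "l n < l (Suc n)" and h_eq: "i \<in> support L (p n) \<Longrightarrow> h (Suc n) i = h n i"
    and keep: "i \<in> F n \<Longrightarrow> a \<in> p n i \<Longrightarrow> length a = l n \<Longrightarrow> a \<in> p (Suc n) i"
    and split: "i \<in> F n \<Longrightarrow> splits_between (p (Suc n) i) (l n) (l (Suc n))"
    and in_D: "\<sigma> \<in> level_choices (p n) (F n) (l n) \<Longrightarrow> refine (p (Suc n)) (F n) \<sigma> \<in> D n" for n i a \<sigma>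
    using x(2)[of n] unfolding fusion_step_def x_eq by (auto simp: below_def sacks_leq_iff)
  have supp_inc: "support L (p n) \<subseteq> support L (p (Suc n))" for n
    by (rule support_mono) (use p_dec in blast)
  have h_stable: "i \<in> support L (p (n + k)) \<and> h (n + k) i = h n i"
    if i: "i \<in> support L (p n)" for i n k
    using i supp_inc h_eq by (induction k) auto
  have F_mono: "F n \<subseteq> F n'" if "n \<le> n'" for n n'
    using lift_Suc_mono_le[of F] F_inc that by blast
  \<comment> \<open>The deadline of \<open>i\<close> does not change after entry, and stage \<open>n + h n i\<close> is past both entry and
    deadline.\<close>
  have caught: "\<exists>m. i \<in> F m" if i: "i \<in> support L (p n)" for i n
    using F(3)[of i "n + h n i"] h_stable[OF i, of "h n i"] by auto
  define q where "q = (\<lambda>i\<in>L. \<Inter>n. p n i)"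
  have q_le: "\<forall>i\<in>L. q i \<subseteq> p n i" for n unfolding q_def by auto
  have q_perfect: "perfect_tree (q i)" if i: "i \<in> L" for i
  proof (cases "\<exists>m. i \<in> F m")
    case True
    then obtain m where "i \<in> F m" by blast
    then have "i \<in> F n" if "m \<le> n" for n using F_mono that by blast
    then have "perfect_tree (\<Inter>n. p n i)"
      using sacks_perfect[OF p(1) i] p_dec[OF i] l_inc keep split
      by (intro perfect_tree_fusion[of _ l m]) auto
    then show ?thesis using i unfolding q_def by simp
  next
    case False
    then have "p n i = UNIV" for n using caught i unfolding support_def by blast
    then show ?thesis using i perfect_tree_UNIV unfolding q_def by simp
  qed
  have "support L q \<subseteq> (\<Union>n. support L (p n))" unfolding support_def q_def by auto
  then have "countable (support L q)"
    using p(1) unfolding sacks_conds_iff by (meson countable_UN countable_subset countableI_type)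
  then have q: "q \<in> conds ?P" using q_perfect unfolding sacks_conds_iff q_def by simp
  have "\<exists>X. finite X \<and> X \<subseteq> D n \<and> predense_below ?P q X" for n
  proof (intro exI conjI)
    \<comment> \<open>Stage \<open>n\<close> fixes the nodes, but only the thinned condition \<open>p (Suc n)\<close> puts the restrictions
      into \<open>D n\<close>.\<close>
    let ?X = "refine (p (Suc n)) (F n) ` level_choices (p (Suc n)) (F n) (l n)"
    show "finite ?X" using finite_level_choices[OF F(1)] by blast
    have "level_choices (p (Suc n)) (F n) (l n) \<subseteq> level_choices (p n) (F n) (l n)"
      using p_dec F(2) by (intro PiE_mono) blast
    then show "?X \<subseteq> D n" using in_D by blast
    have "below ?P q \<subseteq> below ?P (p (Suc n))"
      using q_le[of "Suc n"] unfolding below_def sacks_leq_iff by blast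
    then show "predense_below ?P q ?X"
      using predense_level_choices[OF p(1) F(1,2), of "Suc n" n "l n"]
      unfolding predense_below_def by (meson subsetD)
  qed
  moreover have "q \<in> below ?P p0"
    using q q_le[of 0] p(2)[of 0] unfolding below_def sacks_leq_iff by blast
  ultimately show "\<exists>q\<in>below ?P p0. \<forall>n. \<exists>X. finite X \<and> X \<subseteq> D n \<and> predense_below ?P q X" by blast
qed

theorem lemma4p8:
  fixes \<T> :: "nat list set set"
    and L :: "'l set"
    and p :: "'l \<Rightarrow> bool list set"
    and f :: "('i, 'l \<Rightarrow> bool list set) name"
  assumes "countable \<T>"
    and "adfs_family \<T>"
    and "p \<in> conds (sacks_product L)"
    and "name_for_real (sacks_product L) f"
    and "\<And>T. T \<in> \<T> \<Longrightarrow> f_not (sacks_product L) (f_branch (sacks_product L) f T) p"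
  shows "\<exists>S. \<exists>q \<in> conds (sacks_product L).
    fin_splitting_tree S \<and> leq (sacks_product L) q p \<and>
    adfs_family (\<T> \<union> {S}) \<and> f_branch (sacks_product L) f S q"
proof -
  have real: "f_real (sacks_product L) f (top_cond (sacks_product L))"
    using assms(4) unfolding name_for_real_def by blast
  have "p \<in> below (sacks_product L) (top_cond (sacks_product L))"
    using assms(3) unfolding below_def sacks_leq_iff by (simp add: sacks_product_def)
  from new_tree_if_finite_capture[OF preordered_sacks finite_capture_sacks assms(1,2) real this assms(5)]
  show ?thesis unfolding below_def by blast
qed

end
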